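(* Let $(X,K,\|\cdot\|)$ be an ordered Banach space whose norm is semimonotone. If $A\in\mathcal{L}(X)$ is local, then $e^{tA}$ is local for every $t\in\mathbb{R}$.
   Context: All vector spaces are real. A cone $K$ in $X$ is a subset with $\lambda x+\mu y\in K$ for all $x,y\in K$, $\lambda,\mu\ge 0$, and $K\cap(-K)=\{0\}$; it induces the partial order $x\le y:\Leftrightarrow y-x\in K$. $K$ is generating if $X=K-K$. An ordered Banach space $(X,K,\|\cdot\|)$ is a Banach space $(X,\|\cdot\|)$ with a closed generating cone $K$. The norm is semimonotone if there is a constant $M\in\mathbb{R}$ such that $0\le x\le y$ implies $\|x\|\le M\|y\|$. For $S\subseteq X$, $S^{\mathrm{u}}=\{x\in X: x\ge s\text{ for all }s\in S\}$ is the set of upper bounds. Elements $x,y\in X$ are disjoint, $x\perp y$, if $\{x+y,-x-y\}^{\mathrm{u}}=\{x-y,-x+y\}^{\mathrm{u}}$. $\mathcal{L}(X)$ denotes the bounded linear operators on $X$. A linear operator $A\colon X\to X$ is local if for all $x,y\in X$ with $x\perp y$ one has $Ax\perp y$. *)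

theory Defs
  imports "HOL-Analysis.Analysis"
begin

text \<open>
  The carrier of the ordered space is a whole type \<open>'a\<close>; the cone \<open>K\<close> is an explicit parameter.
  Membership of \<open>0\<close> in a cone, hence nonemptiness, comes from the last conjunct below.
\<close>

definition order_cone :: "'a::real_vector set \<Rightarrow> bool" where
  "order_cone K \<longleftrightarrow>
     (\<forall>x\<in>K. \<forall>y\<in>K. \<forall>a\<ge>0. \<forall>b\<ge>0. a *\<^sub>R x + b *\<^sub>R y \<in> K) \<and> K \<inter> uminus ` K = {0}"

definition cone_le :: "'a::real_vector set \<Rightarrow> 'a \<Rightarrow> 'a \<Rightarrow> bool" where
  "cone_le K x y \<longleftrightarrow> y - x \<in> K"

definition generating :: "'a::real_vector set \<Rightarrow> bool" where
  "generating K \<longleftrightarrow> UNIV = {x - y | x y. x \<in> K \<and> y \<in> K}"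

definition ordered_banach_space :: "'a::banach set \<Rightarrow> bool" where
  "ordered_banach_space K \<longleftrightarrow> order_cone K \<and> closed K \<and> generating K"

definition semimonotone_norm :: "'a::real_normed_vector set \<Rightarrow> bool" where
  "semimonotone_norm K \<longleftrightarrow>
     (\<exists>M::real. \<forall>x y. cone_le K 0 x \<and> cone_le K x y \<longrightarrow> norm x \<le> M * norm y)"

definition upper_bounds :: "'a::real_vector set \<Rightarrow> 'a set \<Rightarrow> 'a set" where
  "upper_bounds K S = {x. \<forall>s\<in>S. cone_le K s x}"

definition disjoint_elements :: "'a::real_vector set \<Rightarrow> 'a \<Rightarrow> 'a \<Rightarrow> bool" where
  "disjoint_elements K x y \<longleftrightarrow>
     upper_bounds K {x + y, - x - y} = upper_bounds K {x - y, - x + y}"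

definition local_operator :: "'a::real_vector set \<Rightarrow> ('a \<Rightarrow> 'a) \<Rightarrow> bool" where
  "local_operator K A \<longleftrightarrow>
     linear A \<and> (\<forall>x y. disjoint_elements K x y \<longrightarrow> disjoint_elements K (A x) y)"

text \<open>
  The constant \<open>exp\<close> is restricted to \<open>real_normed_algebra_1\<close>, whose axiom \<open>norm 1 = 1\<close>
  fails for the operators on the zero space. The exponential of a bounded operator is therefore
  defined by its power series, with the limit taken in the operator norm.
\<close>

definition blinfun_power ::
    "('a::real_normed_vector \<Rightarrow>\<^sub>L 'a) \<Rightarrow> nat \<Rightarrow> ('a \<Rightarrow>\<^sub>L 'a)" where
  "blinfun_power A n = ((\<lambda>B. A o\<^sub>L B) ^^ n) id_blinfun"

definition blinfun_exp :: "('a::banach \<Rightarrow>\<^sub>L 'a) \<Rightarrow> ('a \<Rightarrow>\<^sub>L 'a)" where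
  "blinfun_exp A = (\<Sum>n. (1 / fact n) *\<^sub>R blinfun_power A n)"

lemma norm_blinfun_power_le: "norm (blinfun_power A n) \<le> norm A ^ n"
proof (induction n)
  case 0
  show ?case by (simp add: blinfun_power_def norm_blinfun_id_le)
next
  case (Suc n)
  have "norm (blinfun_power A (Suc n)) \<le> norm A * norm (blinfun_power A n)"
    by (simp add: blinfun_power_def norm_blinfun_compose)
  also have "\<dots> \<le> norm A * norm A ^ n"
    using Suc by (simp add: mult_left_mono)
  finally show ?case by simp
qed

lemma blinfun_exp_sums:
  fixes A :: "'a::banach \<Rightarrow>\<^sub>L 'a"
  shows "(\<lambda>n. (1 / fact n) *\<^sub>R blinfun_power A n) sums blinfun_exp A"
proof -
  have "summable (\<lambda>n. (1 / fact n) *\<^sub>R blinfun_power A n)"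
  proof (rule summable_comparison_test')
    show "summable (\<lambda>n. norm A ^ n /\<^sub>R fact n)"
      by (rule summable_exp_generic)
    show "norm ((1 / fact n) *\<^sub>R blinfun_power A n) \<le> norm A ^ n /\<^sub>R fact n" if "n \<ge> 0" for n
      using norm_blinfun_power_le[of A n] by (simp add: divide_simps)
  qed
  then show ?thesis
    unfolding blinfun_exp_def by (rule summable_sums)
qed

end

theory Submission
  imports Defs
begin

text \<open>
  Disjointness of \<open>x\<close> and \<open>y\<close> means that the infimum of \<open>|x|\<close> and \<open>|y|\<close>, formed in the Dedekind
  completion, is zero; this can be said inside the space: every \<open>w\<close> that lies below all upper
  bounds of \<open>{x, -x}\<close> and below all upper bounds of \<open>{y, -y}\<close> satisfies \<open>w \<le> 0\<close>.
  In this form the elements disjoint from a fixed \<open>y\<close> are seen to be a linear subspace. It is closed,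
  because in an ordered Banach space small elements \<open>d\<close> have small upper bounds of \<open>{d, -d}\<close>
  (a form of Ando's theorem, obtained from Baire category). Finally, the powers of a local operator
  map this subspace into itself, and hence so does the limit of the exponential series.
\<close>

text \<open>A substitute for the principal up-set of \<open>|x|\<close>: the upper bounds of
  \<open>{x, -x}\<close> need not have a least element.\<close>

definition abs_bounds :: "'a::real_vector set \<Rightarrow> 'a \<Rightarrow> 'a set" where
  "abs_bounds K x = {u. u - x \<in> K \<and> u + x \<in> K}"

definition meet_trivial :: "'a::real_vector set \<Rightarrow> 'a \<Rightarrow> 'a \<Rightarrow> bool" where
  "meet_trivial K x y \<longleftrightarrow>
     (\<forall>w. (\<forall>u\<in>abs_bounds K x. u - w \<in> K) \<and> (\<forall>v\<in>abs_bounds K y. v - w \<in> K) \<longrightarrow> - w \<in> K)"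

lemma meet_trivialD:
  assumes "meet_trivial K x y" "\<And>u. u \<in> abs_bounds K x \<Longrightarrow> u - w \<in> K"
    "\<And>v. v \<in> abs_bounds K y \<Longrightarrow> v - w \<in> K"
  shows "- w \<in> K"
  using assms unfolding meet_trivial_def by blast

section \<open>Cone arithmetic and upper bounds of \<open>{x, -x}\<close>\<close>

lemma order_cone_comb:
  assumes "order_cone K" "x \<in> K" "y \<in> K" "a \<ge> 0" "b \<ge> 0"
  shows "a *\<^sub>R x + b *\<^sub>R y \<in> K"
  using assms unfolding order_cone_def by blast

lemma order_cone_zero: "order_cone K \<Longrightarrow> 0 \<in> K"
  unfolding order_cone_def by blast

lemma order_cone_add: "order_cone K \<Longrightarrow> x \<in> K \<Longrightarrow> y \<in> K \<Longrightarrow> x + y \<in> K"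
  using order_cone_comb[of K x y 1 1] by simp

lemma order_cone_scaleR: "order_cone K \<Longrightarrow> x \<in> K \<Longrightarrow> a \<ge> 0 \<Longrightarrow> a *\<^sub>R x \<in> K"
  using order_cone_comb[of K x x a 0] by simp

lemma order_cone_half: "order_cone K \<Longrightarrow> x + x \<in> K \<Longrightarrow> x \<in> K"
  using order_cone_scaleR[of K "x + x" "1/2"] by (simp flip: scaleR_2)

lemma order_cone_sum:
  assumes "order_cone K" "\<And>i. i \<in> I \<Longrightarrow> f i \<in> K"
  shows "sum f I \<in> K"
  using assms(2) by (induction I rule: infinite_finite_induct)
    (auto simp: order_cone_zero[OF assms(1)] intro: order_cone_add[OF assms(1)])

lemma abs_bounds_uminus [simp]: "abs_bounds K (- x) = abs_bounds K x"
  unfolding abs_bounds_def by auto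

lemma abs_bounds_minus_commute: "abs_bounds K (x - y) = abs_bounds K (y - x)"
  using abs_bounds_uminus[of K "y - x"] by simp

lemma abs_bounds_nonneg:
  assumes "order_cone K" "u \<in> abs_bounds K x"
  shows "u \<in> K"
  using order_cone_add[OF assms(1), of "u - x" "u + x"] assms(2)
  by (auto simp: abs_bounds_def intro: order_cone_half[OF assms(1)])

lemma abs_bounds_zero: "order_cone K \<Longrightarrow> 0 \<in> abs_bounds K 0"
  by (simp add: abs_bounds_def order_cone_zero)

lemma abs_bounds_add:
  assumes "order_cone K" "u \<in> abs_bounds K x" "v \<in> abs_bounds K y"
  shows "u + v \<in> abs_bounds K (x + y)"
  using order_cone_add[OF assms(1), of "u - x" "v - y"]
    order_cone_add[OF assms(1), of "u + x" "v + y"] assms(2,3)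
  by (simp add: abs_bounds_def algebra_simps)

lemma abs_bounds_scaleR:
  assumes "order_cone K" "u \<in> abs_bounds K x"
  shows "\<bar>c\<bar> *\<^sub>R u \<in> abs_bounds K (c *\<^sub>R x)"
  using order_cone_scaleR[OF assms(1), of "u - x" "\<bar>c\<bar>"]
    order_cone_scaleR[OF assms(1), of "u + x" "\<bar>c\<bar>"] assms(2)
  by (cases "c \<ge> 0") (simp_all add: abs_bounds_def algebra_simps)

lemma abs_bounds_nonempty:
  assumes "order_cone K" "generating K"
  shows "\<exists>u. u \<in> abs_bounds K x"
proof -
  obtain p q where pq: "p \<in> K" "q \<in> K" "x = p - q"
    using assms(2) unfolding generating_def by blast
  then have "p + q \<in> abs_bounds K x"
    using order_cone_add[OF assms(1), of p p] order_cone_add[OF assms(1), of q q]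
    by (simp add: abs_bounds_def)
  then show ?thesis by blast
qed

section \<open>Disjointness as triviality of the meet\<close>

lemma disjoint_elements_iff_abs_bounds:
  "disjoint_elements K x y \<longleftrightarrow> abs_bounds K (x + y) = abs_bounds K (x - y)"
proof -
  have "upper_bounds K {x + y, - x - y} = abs_bounds K (x + y)"
    "upper_bounds K {x - y, - x + y} = abs_bounds K (x - y)"
    by (auto simp: upper_bounds_def cone_le_def abs_bounds_def algebra_simps)
  then show ?thesis by (simp add: disjoint_elements_def)
qed

lemma meet_trivial_uminus [simp]:
  "meet_trivial K (- x) y = meet_trivial K x y" "meet_trivial K x (- y) = meet_trivial K x y"
  by (simp_all add: meet_trivial_def)

text \<open>The value \<open>w = (x - y - v) / 2\<close> lies below \<open>x\<close> and below \<open>-y\<close>.\<close>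

lemma meet_trivial_imp_le:
  assumes K: "order_cone K" and xy: "meet_trivial K x y" and v: "v \<in> abs_bounds K (x + y)"
  shows "v - (x - y) \<in> K"
proof -
  define w where "w = (1/2) *\<^sub>R (x - y - v)"
  have w2: "w + w = x - y - v"
    unfolding w_def by (simp flip: scaleR_2)
  have "x - w \<in> K"
  proof (rule order_cone_half[OF K])
    have "x - w + (x - w) = x + x - (w + w)" by (simp add: algebra_simps)
    also have "\<dots> = v + (x + y)" unfolding w2 by (simp add: algebra_simps)
    finally show "x - w + (x - w) \<in> K" using v by (simp only: abs_bounds_def mem_Collect_eq)
  qed
  moreover have "- y - w \<in> K"
  proof (rule order_cone_half[OF K])
    have "- y - w + (- y - w) = - y - y - (w + w)" by (simp add: algebra_simps)
    also have "\<dots> = v - (x + y)" unfolding w2 by (simp add: algebra_simps)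
    finally show "- y - w + (- y - w) \<in> K" using v by (simp only: abs_bounds_def mem_Collect_eq)
  qed
  ultimately have w: "x - w \<in> K" "- y - w \<in> K" by blast+
  have "- w \<in> K"
  proof (rule meet_trivialD[OF xy])
    show "u - w \<in> K" if "u \<in> abs_bounds K x" for u
      using order_cone_add[OF K, of "u - x" "x - w"] that w(1) by (simp add: abs_bounds_def)
    show "u - w \<in> K" if "u \<in> abs_bounds K y" for u
      using order_cone_add[OF K, of "u + y" "- y - w"] that w(2) by (simp add: abs_bounds_def)
  qed
  then have "- w + - w \<in> K" using order_cone_add[OF K] by blast
  moreover have "- w + - w = - (w + w)" by simp
  ultimately show ?thesis unfolding w2 by simp
qed

text \<open>Both hypotheses on \<open>x\<close>, \<open>y\<close>, \<open>v\<close> survive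
  replacing \<open>(x, y)\<close> by \<open>(-x, -y)\<close>, so the one-sided estimate, used for
  both pairs, gives both halves of the membership.\<close>

lemma meet_trivial_imp_abs_bounds_subset:
  assumes "order_cone K" "meet_trivial K x y"
  shows "abs_bounds K (x + y) \<subseteq> abs_bounds K (x - y)"
proof
  fix v assume v: "v \<in> abs_bounds K (x + y)"
  then have "v \<in> abs_bounds K (- x + - y)"
    using abs_bounds_uminus[of K "x + y"] by simp
  then have "v - (- x - - y) \<in> K"
    using meet_trivial_imp_le[of K "- x" "- y" v] assms by simp
  moreover have "v - (x - y) \<in> K"
    by (rule meet_trivial_imp_le[OF assms v])
  ultimately show "v \<in> abs_bounds K (x - y)"
    by (simp add: abs_bounds_def algebra_simps)
qed

lemma meet_trivial_imp_disjoint: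
  assumes "order_cone K" "meet_trivial K x y"
  shows "disjoint_elements K x y"
  unfolding disjoint_elements_iff_abs_bounds
  using meet_trivial_imp_abs_bounds_subset[OF assms]
    meet_trivial_imp_abs_bounds_subset[of K x "- y"] assms by auto

text \<open>In a vector lattice this says that \<open>x + y\<close> is at most the supremum of
  \<open>x\<close> and \<open>y\<close>: that supremum is half of \<open>x + y + |x - y|\<close>,
  and disjointness turns \<open>|x - y|\<close> into \<open>|x + y|\<close>.\<close>

lemma disjoint_imp_le:
  assumes K: "order_cone K" and d: "abs_bounds K (x + y) = abs_bounds K (x - y)"
    and s: "s - x \<in> K" "s - y \<in> K"
  shows "s - (x + y) \<in> K"
proof -
  \<comment> \<open>Reflecting the upper bound \<open>s\<close> gives a common lower bound
    \<open>l\<close> of \<open>x\<close> and \<open>y\<close>; hence \<open>x + y - 2 l\<close>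
    dominates \<open>x - y\<close> and \<open>y - x\<close>, and by \<open>d\<close> also
    \<open>x + y\<close>.\<close>
  define l where "l = x + y - s"
  have "x - l \<in> K" "y - l \<in> K" using s by (simp_all add: l_def)
  then have "(x + y - (l + l)) \<in> abs_bounds K (x - y)"
    using order_cone_add[OF K, of "x - l" "x - l"] order_cone_add[OF K, of "y - l" "y - l"]
    by (simp add: abs_bounds_def algebra_simps)
  then have "(x + y - (l + l)) - (x + y) \<in> K" using d unfolding abs_bounds_def by blast
  then have "- l + - l \<in> K" by (simp add: algebra_simps)
  then have "- l \<in> K" by (rule order_cone_half[OF K])
  then show ?thesis by (simp add: l_def)
qed

lemma disjoint_imp_abs_bounds:
  assumes K: "order_cone K" and d: "abs_bounds K (x + y) = abs_bounds K (x - y)"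
    and s: "s \<in> abs_bounds K x" "s \<in> abs_bounds K y"
  shows "s \<in> abs_bounds K (x + y)"
proof -
  have "s - (- x + - y) \<in> K"
    using d s abs_bounds_uminus[of K "x + y"] abs_bounds_minus_commute[of K x y]
    by (intro disjoint_imp_le[OF K]) (simp_all add: abs_bounds_def)
  moreover have "s - (x + y) \<in> K"
    using s by (intro disjoint_imp_le[OF K d]) (simp_all add: abs_bounds_def)
  ultimately show ?thesis by (simp add: abs_bounds_def algebra_simps)
qed

text \<open>Divide by the positive integer \<open>Suc n\<close> and let \<open>n\<close> tend to
  infinity; closedness keeps the limit in the cone.\<close>

lemma closed_cone_archimedean:
  fixes K :: "'a::real_normed_vector set"
  assumes K: "order_cone K" "closed K" and "\<And>n. v - real n *\<^sub>R w \<in> K"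
  shows "- w \<in> K"
proof (rule closed_sequentially[OF K(2)])
  show "inverse (real (Suc n)) *\<^sub>R v - w \<in> K" for n
    using order_cone_scaleR[OF K(1) assms(3)[of "Suc n"], of "inverse (real (Suc n))"]
    by (simp add: scaleR_right_diff_distrib del: of_nat_Suc)
  have "(\<lambda>n. inverse (real (Suc n)) *\<^sub>R v - w) \<longlonglongrightarrow> 0 *\<^sub>R v - w"
    by (intro tendsto_intros LIMSEQ_inverse_real_of_nat)
  then show "(\<lambda>n. inverse (real (Suc n)) *\<^sub>R v - w) \<longlonglongrightarrow> - w" by simp
qed

text \<open>
  If \<open>w\<close> lies below \<open>|x|\<close> and \<open>|y|\<close>, then subtracting \<open>w\<close> does not leave the set of upper bounds
  of \<open>{x + y, -x - y}\<close>, so the Archimedean property gives \<open>w \<le> 0\<close>.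
\<close>

lemma disjoint_imp_meet_trivial:
  fixes K :: "'a::real_normed_vector set"
  assumes K: "order_cone K" "closed K" "generating K" and "disjoint_elements K x y"
  shows "meet_trivial K x y"
  unfolding meet_trivial_def
proof (intro allI impI, elim conjE)
  fix w
  assume wx: "\<forall>u\<in>abs_bounds K x. u - w \<in> K" and wy: "\<forall>v\<in>abs_bounds K y. v - w \<in> K"
  have d: "abs_bounds K (x + y) = abs_bounds K (x - y)"
    using assms(4) by (simp add: disjoint_elements_iff_abs_bounds)
  have step: "v - w \<in> abs_bounds K (x + y)" if v: "v \<in> abs_bounds K (x + y)" for v
  proof (rule disjoint_imp_abs_bounds[OF K(1) d])
    have v': "v \<in> abs_bounds K (x - y)" using v d by simp
    \<comment> \<open>Since \<open>v\<close> dominates \<open>x + y\<close>, \<open>x - y\<close>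
      and their negatives, shifting \<open>v\<close> by one variable bounds the absolute value of
      the other. As \<open>w\<close> lies below all these shifts, \<open>v - w\<close> still
      dominates \<open>x\<close>, \<open>-x\<close>, \<open>y\<close> and \<open>-y\<close>.\<close>
    have "v - y \<in> abs_bounds K x" "v + y \<in> abs_bounds K x"
      "v - x \<in> abs_bounds K y" "v + x \<in> abs_bounds K y"
      using v v' by (simp_all add: abs_bounds_def algebra_simps)
    then have "v - y - w \<in> K" "v + y - w \<in> K" "v - x - w \<in> K" "v + x - w \<in> K"
      using wx wy by blast+
    then show "v - w \<in> abs_bounds K x" "v - w \<in> abs_bounds K y"
      by (simp_all add: abs_bounds_def algebra_simps)
  qed
  obtain v where v: "v \<in> abs_bounds K (x + y)"
    using abs_bounds_nonempty[OF K(1,3)] by blast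
  have "v - real n *\<^sub>R w \<in> abs_bounds K (x + y)" for n
  proof (induction n)
    case (Suc n)
    then show ?case using step[OF Suc.IH] by (simp add: algebra_simps)
  qed (simp add: v)
  then show "- w \<in> K"
    using abs_bounds_nonneg[OF K(1)] by (intro closed_cone_archimedean[OF K(1,2), of v]) blast
qed

lemma disjoint_iff_meet_trivial:
  fixes K :: "'a::real_normed_vector set"
  assumes "order_cone K" "closed K" "generating K"
  shows "disjoint_elements K x y \<longleftrightarrow> meet_trivial K x y"
  using assms disjoint_imp_meet_trivial meet_trivial_imp_disjoint by blast

section \<open>The elements disjoint from \<open>y\<close> form a subspace\<close>

text \<open>The element \<open>w - u\<close> lies below \<open>|x|\<close>, because
  \<open>|x| + u\<close> dominates \<open>|x + z|\<close>, and below \<open>|y|\<close>, because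
  \<open>u\<close> is positive. This perturbation estimate serves both sums and limits.\<close>

lemma meet_trivial_diff_le:
  assumes K: "order_cone K" and xy: "meet_trivial K x y" and u: "u \<in> abs_bounds K z"
    and wx: "\<And>u. u \<in> abs_bounds K (x + z) \<Longrightarrow> u - w \<in> K"
    and wy: "\<And>v. v \<in> abs_bounds K y \<Longrightarrow> v - w \<in> K"
  shows "u - w \<in> K"
proof -
  have "- (w - u) \<in> K"
  proof (rule meet_trivialD[OF xy])
    show "v - (w - u) \<in> K" if "v \<in> abs_bounds K x" for v
      using wx[OF abs_bounds_add[OF K that u]] by (simp add: algebra_simps)
    show "v - (w - u) \<in> K" if "v \<in> abs_bounds K y" for v
      using order_cone_add[OF K wy[OF that] abs_bounds_nonneg[OF K u]]
      by (simp add: algebra_simps)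
  qed
  then show ?thesis by simp
qed

lemma meet_trivial_zero: "order_cone K \<Longrightarrow> meet_trivial K 0 y"
  unfolding meet_trivial_def by (metis abs_bounds_zero diff_0)

text \<open>A common lower bound of \<open>|x + z|\<close> and \<open>|y|\<close> lies below every
  bound of \<open>{z, -z}\<close> by the perturbation estimate, so it competes in the definition for
  \<open>z\<close> and \<open>y\<close>.\<close>

lemma meet_trivial_add:
  assumes K: "order_cone K" and x: "meet_trivial K x y" and z: "meet_trivial K z y"
  shows "meet_trivial K (x + z) y"
  unfolding meet_trivial_def
  using meet_trivial_diff_le[OF K x] by (blast intro: meet_trivialD[OF z])

text \<open>For such \<open>c\<close> the element \<open>|c| u\<close> is at most \<open>u\<close>,
  so whatever lies below \<open>|c x|\<close> lies below \<open>|x|\<close>.\<close>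

lemma meet_trivial_scaleR_le_one:
  assumes K: "order_cone K" and x: "meet_trivial K x y" and c: "\<bar>c\<bar> \<le> 1"
  shows "meet_trivial K (c *\<^sub>R x) y"
  unfolding meet_trivial_def
proof (intro allI impI, elim conjE)
  fix w assume w: "\<forall>u\<in>abs_bounds K (c *\<^sub>R x). u - w \<in> K" "\<forall>v\<in>abs_bounds K y. v - w \<in> K"
  show "- w \<in> K"
  proof (rule meet_trivialD[OF x])
    fix u assume u: "u \<in> abs_bounds K x"
    have "\<bar>c\<bar> *\<^sub>R u - w \<in> K" using abs_bounds_scaleR[OF K u] w(1) by blast
    moreover have "(1 - \<bar>c\<bar>) *\<^sub>R u \<in> K"
      using c by (intro order_cone_scaleR[OF K abs_bounds_nonneg[OF K u]]) simp
    ultimately have "\<bar>c\<bar> *\<^sub>R u - w + (1 - \<bar>c\<bar>) *\<^sub>R u \<in> K" by (rule order_cone_add[OF K])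
    then show "u - w \<in> K" by (simp add: algebra_simps)
  qed (use w(2) in blast)
qed

lemma meet_trivial_scaleR:
  assumes K: "order_cone K" and x: "meet_trivial K x y"
  shows "meet_trivial K (c *\<^sub>R x) y"
proof -
  obtain n :: nat where n: "\<bar>c\<bar> < real n" using reals_Archimedean2 by blast
  then have n0: "n > 0" by (cases n) auto
  \<comment> \<open>A large factor is reached by adding \<open>n\<close> copies of the small
    multiple \<open>(c / n) x\<close>.\<close>
  have "meet_trivial K (real m *\<^sub>R (c / real n) *\<^sub>R x) y" for m
  proof (induction m)
    case 0
    then show ?case by (simp add: meet_trivial_zero[OF K])
  next
    case (Suc m)
    have "meet_trivial K ((c / real n) *\<^sub>R x) y"
      using n n0 by (intro meet_trivial_scaleR_le_one[OF K x]) simp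
    from meet_trivial_add[OF K this Suc.IH] show ?case
      by (simp only: of_nat_Suc scaleR_add_left scaleR_one)
  qed
  from this[of n] show ?thesis using n0 by simp
qed

lemma subspace_meet_trivial: "order_cone K \<Longrightarrow> subspace {x. meet_trivial K x y}"
  by (auto simp: subspace_def meet_trivial_zero meet_trivial_add meet_trivial_scaleR)

section \<open>Small upper bounds by Baire category\<close>

lemma Baire_sequence:
  fixes D :: "nat \<Rightarrow> 'a::banach set"
  assumes "(\<Union>n. D n) = UNIV"
  shows "\<exists>n. interior (closure (D n)) \<noteq> {}"
proof (rule ccontr)
  assume "\<not> ?thesis"
  then have D: "interior (closure (D n)) = {}" for n by blast
  have "completely_metrizable_space (euclidean :: 'a topology)"
    by (rule completely_metrizable_space_euclidean)
  then have "euclidean interior_of (\<Union>(range (\<lambda>n. closure (D n)))) = {}"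
    using D by (intro Baire_category_alt) auto
  moreover have "\<Union>(range (\<lambda>n. closure (D n))) = UNIV"
    using assms closure_subset by blast
  ultimately show False by simp
qed

text \<open>The elements with a bound of norm at most \<open>n\<close> exhaust the space as
  \<open>n\<close> grows, so for some \<open>n\<close> they are dense in a ball. These sets are
  symmetric and convex, so the ball can be moved to the origin; scaling then covers all
  \<open>x\<close>.\<close>

lemma abs_bounds_dense:
  fixes K :: "'a::banach set"
  assumes K: "order_cone K" and "generating K"
  obtains c where "c \<ge> 0"
    "\<And>x e. e > 0 \<Longrightarrow> \<exists>y u. u \<in> abs_bounds K y \<and> norm u \<le> c * norm x \<and> norm (x - y) < e"
proof -
  define D where "D n = {x. \<exists>u\<in>abs_bounds K x. norm u \<le> real n}" for n
  have "(\<Union>n. D n) = UNIV"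
    unfolding D_def using abs_bounds_nonempty[OF assms] real_arch_simple by blast
  then obtain n where "interior (closure (D n)) \<noteq> {}" using Baire_sequence by blast
  then obtain z r where r: "r > 0" "ball z r \<subseteq> closure (D n)"
    by (metis ex_in_conv mem_interior)
  have near: "\<exists>y\<in>D n. norm (d - y) < e" if d: "norm d < r" and e: "e > 0" for d e
  proof -
    have "z + d \<in> closure (D n)" "z - d \<in> closure (D n)"
      using r(2) d by (auto simp: dist_norm subset_iff)
    then obtain a b where ab: "a \<in> D n" "dist a (z + d) < e" "b \<in> D n" "dist b (z - d) < e"
      using e unfolding closure_approachable by blast
    then obtain u v where uv: "u \<in> abs_bounds K a" "norm u \<le> real n"
      "v \<in> abs_bounds K b" "norm v \<le> real n"
      unfolding D_def by blast
    \<comment> \<open>The center \<open>z\<close> cancels in the difference: \<open>d\<close> is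
      half of \<open>(z + d) - (z - d)\<close>.\<close>
    let ?y = "(1/2) *\<^sub>R (a + - b)"
    have "\<bar>1/2\<bar> *\<^sub>R (u + v) \<in> abs_bounds K ?y"
      using uv by (intro abs_bounds_scaleR[OF K] abs_bounds_add[OF K]) simp_all
    moreover have "norm (\<bar>1/2\<bar> *\<^sub>R (u + v)) \<le> real n"
      using uv norm_triangle_ineq[of u v] by simp
    ultimately have "?y \<in> D n" unfolding D_def by blast
    moreover have "norm (d - ?y) < e"
    proof -
      have "d - ?y = (1/2) *\<^sub>R ((z + d - a) - (z - d - b))"
        by (simp add: algebra_simps flip: scaleR_2)
      also have "norm \<dots> \<le> (1/2) * (norm (z + d - a) + norm (z - d - b))"
        using norm_triangle_ineq4[of "z + d - a" "z - d - b"] by simp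
      also have "\<dots> < e" using ab by (simp add: dist_norm norm_minus_commute)
      finally show ?thesis .
    qed
    ultimately show ?thesis by blast
  qed
  show thesis
  proof (rule that[of "2 * real n / r"])
    show "2 * real n / r \<ge> 0" using r by simp
    fix x :: 'a and e :: real assume e: "e > 0"
    show "\<exists>y u. u \<in> abs_bounds K y \<and> norm u \<le> 2 * real n / r * norm x \<and> norm (x - y) < e"
    proof (cases "x = 0")
      case True
      then show ?thesis using abs_bounds_zero[OF K] e by (intro exI[of _ 0]) simp
    next
      case False
      \<comment> \<open>Scaling by \<open>s\<close> gives \<open>x\<close> norm
        \<open>r / 2\<close>, inside the ball. Undoing it multiplies the bound \<open>n\<close> by
        \<open>2 * norm x / r\<close> and the tolerance \<open>s * e\<close> by
        \<open>1 / s\<close>.\<close>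
      define s where "s = r / (2 * norm x)"
      have s: "s > 0" using r False by (simp add: s_def)
      have "norm (s *\<^sub>R x) < r" using r False by (simp add: s_def)
      then obtain y where y: "y \<in> D n" "norm (s *\<^sub>R x - y) < s * e"
        using near[of "s *\<^sub>R x" "s * e"] s e by auto
      then obtain u where u: "u \<in> abs_bounds K y" "norm u \<le> real n" unfolding D_def by blast
      have "inverse s *\<^sub>R u \<in> abs_bounds K (inverse s *\<^sub>R y)"
        using abs_bounds_scaleR[OF K u(1), of "inverse s"] s by simp
      moreover have "norm (inverse s *\<^sub>R u) \<le> 2 * real n / r * norm x"
        using u(2) s r False mult_left_mono[OF u(2), of "inverse s"]
        by (simp add: s_def field_simps)
      moreover have "norm (x - inverse s *\<^sub>R y) < e"
      proof -
        have "x - inverse s *\<^sub>R y = inverse s *\<^sub>R (s *\<^sub>R x - y)"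
          using s by (simp add: scaleR_right_diff_distrib)
        also have "norm \<dots> = inverse s * norm (s *\<^sub>R x - y)"
          using s by simp
        also have "\<dots> < inverse s * (s * e)"
          using y(2) s by (intro mult_strict_left_mono) simp_all
        also have "\<dots> = e" using s by simp
        finally show ?thesis .
      qed
      ultimately show ?thesis by blast
    qed
  qed
qed

text \<open>Successive approximation as in the open mapping theorem: approximate \<open>x\<close> up
  to half its norm, repeat with the remainder, and add up the approximants and their bounds.\<close>

lemma abs_bounds_small:
  fixes K :: "'a::banach set"
  assumes K: "order_cone K" "closed K" "generating K"
  obtains c where "\<And>x. \<exists>u\<in>abs_bounds K x. norm u \<le> c * norm x"
proof -
  obtain c where c: "c \<ge> 0"
    "\<And>x e. e > 0 \<Longrightarrow> \<exists>y u. u \<in> abs_bounds K y \<and> norm u \<le> c * norm x \<and> norm (x - y) < e"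
    by (rule abs_bounds_dense[OF K(1,3)]) (rule that)
  have "\<exists>y u. u \<in> abs_bounds K y \<and> norm u \<le> c * norm x \<and> norm (x - y) \<le> norm x / 2" for x
  proof (cases "x = 0")
    case True
    then show ?thesis using abs_bounds_zero[OF K(1)] by (intro exI[of _ 0]) simp
  next
    case False
    then show ?thesis using c(2)[of "norm x / 2" x] by (auto intro: less_imp_le)
  qed
  then obtain Y U where YU: "\<And>x. U x \<in> abs_bounds K (Y x)" "\<And>x. norm (U x) \<le> c * norm x"
    "\<And>x. norm (x - Y x) \<le> norm x / 2"
    by metis
  show thesis
  proof (rule that[of "c * 2"])
    fix x
    \<comment> \<open>\<open>r k\<close> is the remainder after \<open>k\<close> approximations. It
      at least halves in norm each time, so the bounds \<open>U (r k)\<close> are dominated by a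
      geometric series, whose sum gives the factor 2.\<close>
    define r where "r k = ((\<lambda>x. x - Y x) ^^ k) x" for k
    have r_Suc: "r (Suc k) = r k - Y (r k)" and r_0: "r 0 = x" for k
      by (simp_all add: r_def)
    have r_norm: "norm (r k) \<le> norm x * (1/2) ^ k" for k
    proof (induction k)
      case (Suc k)
      then show ?case using YU(3)[of "r k"] by (simp add: r_Suc)
    qed (simp add: r_0)
    have geo: "(\<lambda>k. c * (norm x * (1/2) ^ k)) sums (c * (norm x * 2))"
      using geometric_sums[of "1/2 :: real"] by (intro sums_mult) simp
    have U_norm: "norm (U (r k)) \<le> c * (norm x * (1/2) ^ k)" for k
      using YU(2)[of "r k"] mult_left_mono[OF r_norm c(1)] by (rule order_trans)
    have U_sums: "(\<lambda>k. U (r k)) sums (\<Sum>k. U (r k))"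
      by (intro summable_sums summable_comparison_test'[OF sums_summable[OF geo]] U_norm)
    have "r \<longlonglongrightarrow> 0"
    proof (rule Lim_null_comparison)
      show "\<forall>\<^sub>F k in sequentially. norm (r k) \<le> norm x * (1/2) ^ k" using r_norm by simp
      show "(\<lambda>k. norm x * (1/2) ^ k) \<longlonglongrightarrow> 0"
        by (intro tendsto_mult_right_zero LIMSEQ_power_zero) simp
    qed
    then have "(\<lambda>k. r k - r (Suc k)) sums (r 0 - 0)" by (rule telescope_sums')
    then have Y_sums: "(\<lambda>k. Y (r k)) sums x" by (simp add: r_Suc r_0)
    \<comment> \<open>Applied to the series of \<open>U (r k) - Y (r k)\<close> and
      \<open>U (r k) + Y (r k)\<close>, this carries the termwise domination over to the
      sums.\<close>
    have in_K: "l \<in> K" if "f sums l" "\<And>k. f k \<in> K" for f l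
    proof (rule closed_sequentially[OF K(2)])
      show "sum f {..<n} \<in> K" for n using that(2) by (rule order_cone_sum[OF K(1)])
      show "(\<lambda>n. sum f {..<n}) \<longlonglongrightarrow> l" using that(1) by (simp add: sums_def)
    qed
    show "\<exists>u\<in>abs_bounds K x. norm u \<le> c * 2 * norm x"
    proof (intro bexI)
      show "(\<Sum>k. U (r k)) \<in> abs_bounds K x"
        using in_K[OF sums_diff[OF U_sums Y_sums]] in_K[OF sums_add[OF U_sums Y_sums]] YU(1)
        by (simp add: abs_bounds_def)
      show "norm (\<Sum>k. U (r k)) \<le> c * 2 * norm x"
        using norm_suminf_le[OF U_norm sums_summable[OF geo]] sums_unique[OF geo]
        by (simp add: mult_ac)
    qed
  qed
qed

section \<open>Closedness and the exponential series\<close>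

text \<open>Write \<open>x\<close> as \<open>f n\<close> plus a remainder with a bound
  \<open>u n\<close> tending to 0. The perturbation estimate puts every competitor \<open>w\<close>
  below all \<open>u n\<close>, hence below 0 in the limit.\<close>

lemma closed_meet_trivial:
  fixes K :: "'a::banach set"
  assumes K: "order_cone K" "closed K" "generating K"
  shows "closed {x. meet_trivial K x y}"
  unfolding closed_sequential_limits
proof (intro allI impI, elim conjE)
  fix f x assume f: "\<forall>n. f n \<in> {x. meet_trivial K x y}" "f \<longlonglongrightarrow> x"
  obtain c where c: "\<And>x. \<exists>u\<in>abs_bounds K x. norm u \<le> c * norm x"
    by (rule abs_bounds_small[OF K]) (rule that)
  then have "\<forall>n. \<exists>u. u \<in> abs_bounds K (x - f n) \<and> norm u \<le> c * norm (x - f n)"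
    by blast
  then obtain u where u: "\<And>n. u n \<in> abs_bounds K (x - f n)" "\<And>n. norm (u n) \<le> c * norm (x - f n)"
    by metis
  have "(\<lambda>n. c * norm (x - f n)) \<longlonglongrightarrow> c * norm (x - x)"
    using f(2) by (intro tendsto_intros)
  then have "u \<longlonglongrightarrow> 0"
    using u(2) by (intro Lim_null_comparison[of u]) auto
  have "meet_trivial K x y"
    unfolding meet_trivial_def
  proof (intro allI impI, elim conjE)
    fix w assume w: "\<forall>u\<in>abs_bounds K x. u - w \<in> K" "\<forall>v\<in>abs_bounds K y. v - w \<in> K"
    have "u n - w \<in> K" for n
      using f(1) w by (intro meet_trivial_diff_le[OF K(1) _ u(1)[of n], of "f n" y]) auto
    moreover have "(\<lambda>n. u n - w) \<longlonglongrightarrow> 0 - w"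
      using \<open>u \<longlonglongrightarrow> 0\<close> by (intro tendsto_intros)
    ultimately show "- w \<in> K" using closed_sequentially[OF K(2)] by fastforce
  qed
  then show "x \<in> {x. meet_trivial K x y}" by simp
qed

text \<open>Evaluation at \<open>x\<close> is continuous in the operator norm, so the exponential at
  \<open>x\<close> is a limit of partial sums that stay in \<open>S\<close>.\<close>

lemma blinfun_exp_invariant:
  fixes A :: "'a::banach \<Rightarrow>\<^sub>L 'a"
  assumes S: "subspace S" "closed S" and A: "\<And>x. x \<in> S \<Longrightarrow> blinfun_apply A x \<in> S" and x: "x \<in> S"
  shows "blinfun_apply (blinfun_exp A) x \<in> S"
proof (rule closed_sequentially[OF S(2)])
  have pow: "blinfun_apply (blinfun_power A n) x \<in> S" for n
    by (induction n) (simp_all add: blinfun_power_def x A)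
  show "(\<Sum>k<n. blinfun_apply ((1 / fact k) *\<^sub>R blinfun_power A k) x) \<in> S" for n
    by (intro subspace_sum[OF S(1)]) (simp add: blinfun.scaleR_left subspace_scale[OF S(1) pow])
  show "(\<lambda>n. \<Sum>k<n. blinfun_apply ((1 / fact k) *\<^sub>R blinfun_power A k) x)
      \<longlonglongrightarrow> blinfun_apply (blinfun_exp A) x"
    using bounded_linear.sums[OF blinfun.bounded_linear_left blinfun_exp_sums]
    unfolding sums_def .
qed

theorem theorem5p3:
  fixes K :: "'a::banach set" and A :: "'a \<Rightarrow>\<^sub>L 'a" and t :: real
  assumes "ordered_banach_space K"
    and "semimonotone_norm K"
    and "local_operator K (blinfun_apply A)"
  shows "local_operator K (blinfun_apply (blinfun_exp (t *\<^sub>R A)))"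
  unfolding local_operator_def
proof (intro conjI allI impI)
  have K: "order_cone K" "closed K" "generating K"
    using assms(1) by (simp_all add: ordered_banach_space_def)
  show "linear (blinfun_apply (blinfun_exp (t *\<^sub>R A)))"
    by (intro bounded_linear.linear blinfun.bounded_linear_right)
  fix x y assume "disjoint_elements K x y"
  \<comment> \<open>Locality of \<open>A\<close> and closure under real multiples, so
    \<open>t\<close> may have either sign.\<close>
  moreover have "meet_trivial K (blinfun_apply (t *\<^sub>R A) x) y" if "meet_trivial K x y" for x
    using assms(3) that meet_trivial_scaleR[OF K(1)]
    by (simp add: local_operator_def disjoint_iff_meet_trivial[OF K] blinfun.scaleR_left)
  ultimately show "disjoint_elements K (blinfun_apply (blinfun_exp (t *\<^sub>R A)) x) y"
    using blinfun_exp_invariant[OF subspace_meet_trivial[OF K(1), of y] closed_meet_trivial[OF K, of y],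
        of "t *\<^sub>R A" x]
    by (simp add: disjoint_iff_meet_trivial[OF K])
qed

end
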